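(* For each $n$, let $G_n$ be a finite graph with $n$ vertices and maximum degree $\Delta_n$, let $q_n\ge\Delta_n+2$, and let $X^{(n)}$ be the number of rounds until all players have payoff $1$ (the conflict resolving time) in the self-organizing network coloring game on $G_n$ with $q_n$ colors in which all players use the greedy and selfish strategy, started from an arbitrary initial state. Then $X^{(n)}=O_p(\log n)$: for every $\varepsilon>0$ there exist $M>0$ and $n_0$ such that $\Pr\big[X^{(n)}/\log n> M\big]<\varepsilon$ for all $n>n_0$.
   Context: Network coloring game: players are the vertices $1,\dots,n$ of the graph; $N(i)$ denotes the neighbours of $i$. There are $q$ colors. In discrete rounds $t=0,1,2,\dots$ each player $i$ holds a color $l_i(t)$ and has payoff $U_i(t)=1$ if $l_i(t)\ne l_j(t)$ for all $j\in N(i)$ and $U_i(t)=0$ otherwise. Greedy and selfish strategy: a player with payoff $1$ keeps its color; a player with payoff $0$ chooses its next color uniformly at random among the colors not used by any of its neighbours in the previous round, independently of the other players. The game has converged once all payoffs equal $1$. *)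

theory Defs
  imports "HOL-Probability.Probability"
begin

text \<open>
  The players are \<open>1, \<dots>, n\<close>, the colors are \<open>1, \<dots>, q\<close>, and a state assigns a color to every
  player; states are extensional functions, i.e. undefined outside \<open>{1..n}\<close>.
\<close>

definition simple_graph :: "nat \<Rightarrow> nat rel \<Rightarrow> bool" where
  "simple_graph n E \<longleftrightarrow> E \<subseteq> {1..n} \<times> {1..n} \<and> sym E \<and> irrefl E"

definition neighbours :: "nat rel \<Rightarrow> nat \<Rightarrow> nat set" where
  "neighbours E i = {j. (i, j) \<in> E}"

definition max_degree :: "nat \<Rightarrow> nat rel \<Rightarrow> nat" where
  "max_degree n E = Max ((\<lambda>i. card (neighbours E i)) ` {1..n})"

definition states :: "nat \<Rightarrow> nat \<Rightarrow> (nat \<Rightarrow> nat) set" where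
  "states n q = {1..n} \<rightarrow>\<^sub>E {1..q}"

definition payoff :: "nat rel \<Rightarrow> (nat \<Rightarrow> nat) \<Rightarrow> nat \<Rightarrow> nat" where
  "payoff E l i = (if \<forall>j\<in>neighbours E i. l i \<noteq> l j then 1 else 0)"

definition next_color :: "nat \<Rightarrow> nat rel \<Rightarrow> (nat \<Rightarrow> nat) \<Rightarrow> nat \<Rightarrow> nat pmf" where
  "next_color q E l i =
     (if payoff E l i = 1 then return_pmf (l i)
      else pmf_of_set ({1..q} - l ` neighbours E i))"

text \<open>The product distribution expresses that the players choose independently of each other.\<close>

definition next_state :: "nat \<Rightarrow> nat \<Rightarrow> nat rel \<Rightarrow> (nat \<Rightarrow> nat) \<Rightarrow> (nat \<Rightarrow> nat) pmf" where
  "next_state n q E l = Pi_pmf {1..n} undefined (next_color q E l)"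

text \<open>
  The play is a Markov chain \<open>L 0, L 1, \<dots>\<close> on a probability space \<open>M\<close>: whatever the history
  \<open>h 0, \<dots>, h t\<close>, the conditional law of \<open>L (t + 1)\<close> given that history is
  \<open>next_state n q E (h t)\<close>. The condition is written without division so that it
  also makes sense for histories of probability 0.
\<close>

definition greedy_selfish_game ::
  "'a measure \<Rightarrow> nat \<Rightarrow> nat \<Rightarrow> nat rel \<Rightarrow> (nat \<Rightarrow> nat) \<Rightarrow> (nat \<Rightarrow> 'a \<Rightarrow> nat \<Rightarrow> nat) \<Rightarrow> bool" where
  "greedy_selfish_game M n q E l0 L \<longleftrightarrow>
     prob_space M \<and>
     (\<forall>t. L t \<in> M \<rightarrow>\<^sub>M count_space UNIV) \<and>
     (\<forall>\<omega>\<in>space M. L 0 \<omega> = l0) \<and>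
     (\<forall>t h. \<P>(\<omega> in M. \<forall>s\<le>Suc t. L s \<omega> = h s) =
            \<P>(\<omega> in M. \<forall>s\<le>t. L s \<omega> = h s) * pmf (next_state n q E (h t)) (h (Suc t)))"

text \<open>The infimum of the empty set is \<open>\<infinity>\<close>: a play that never converges has infinite resolving time.\<close>

definition resolving_time :: "nat \<Rightarrow> nat rel \<Rightarrow> (nat \<Rightarrow> nat \<Rightarrow> nat) \<Rightarrow> enat" where
  "resolving_time n E l = Inf (enat ` {t. \<forall>i\<in>{1..n}. payoff E (l t) i = 1})"

end

theory Submission
  imports Defs
begin

text \<open>
  A happy player (payoff 1) stays happy forever. Consider any other player, with \<open>k\<close> free colors and
  \<open>d\<close> unhappy neighbours. Every player always has at least two free colors, so each color is picked by
  a given unhappy neighbour with probability at most 1/2, and by convexity (\<open>1 - x \<ge> exp (- 2 x)\<close>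
  and Jensen) the player becomes happy in the next round with probability at least
  \<open>exp (- 2 d / k)\<close>. The ratio \<open>d / k\<close> may be large. But at least \<open>d\<close> colors are unblocked, i.e. not
  held by happy neighbours, and by the same estimate a constant fraction of these is free after one
  round with constant probability, while \<open>d\<close> does not increase. Hence two rounds make a player happy
  with probability at least an absolute constant \<open>p\<close>, and by the union bound the game is unresolved
  after \<open>2 t\<close> rounds with probability at most \<open>n (1 - p)\<^sup>t\<close>.
\<close>

section \<open>Exponential lower bounds for products\<close>

lemma exp_minus_double_le_one_minus:
  fixes x :: real
  assumes "0 \<le> x" "x \<le> 1 / 2"
  shows "exp (- 2 * x) \<le> 1 - x"
proof -
  have "2 * x\<^sup>2 \<le> x"
    using assms mult_right_mono[of "2 * x" 1 x] by (simp add: power2_eq_square)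
  then have "- 2 * x \<le> ln (1 - x)"
    using ln_one_minus_pos_lower_bound[of x] assms by linarith
  then show ?thesis
    using assms by (simp add: ln_ge_iff)
qed

lemma card_mult_exp_mean_le_sum_exp:
  fixes f :: "'a \<Rightarrow> real"
  assumes "finite A" "A \<noteq> {}"
  shows "card A * exp ((\<Sum>a\<in>A. f a) / card A) \<le> (\<Sum>a\<in>A. exp (f a))"
proof -
  have "card A > 0"
    using assms by (simp add: card_gt_0_iff)
  then have "exp (\<Sum>a\<in>A. (1 / card A) *\<^sub>R f a) \<le> (\<Sum>a\<in>A. 1 / card A * exp (f a))"
    using assms by (intro convex_on_sum[OF _ _ exp_convex]) auto
  then show ?thesis
    using \<open>card A > 0\<close> by (simp add: field_simps flip: sum_divide_distrib)
qed

lemma sum_prod_one_minus_ge: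
  fixes x :: "'u \<Rightarrow> 'c \<Rightarrow> real"
  assumes "finite C" "C \<noteq> {}" "finite U"
    and x: "\<And>u c. u \<in> U \<Longrightarrow> c \<in> C \<Longrightarrow> 0 \<le> x u c \<and> x u c \<le> 1 / 2"
  shows "card C * exp (- 2 * ((\<Sum>u\<in>U. \<Sum>c\<in>C. x u c) / card C)) \<le> (\<Sum>c\<in>C. \<Prod>u\<in>U. 1 - x u c)"
proof -
  have "(\<Sum>c\<in>C. \<Sum>u\<in>U. - 2 * x u c) = - 2 * (\<Sum>u\<in>U. \<Sum>c\<in>C. x u c)"
    by (subst sum.swap) (simp add: sum_distrib_left)
  then have "card C * exp (- 2 * ((\<Sum>u\<in>U. \<Sum>c\<in>C. x u c) / card C))
      \<le> (\<Sum>c\<in>C. exp (\<Sum>u\<in>U. - 2 * x u c))"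
    using card_mult_exp_mean_le_sum_exp[OF assms(1,2), of "\<lambda>c. \<Sum>u\<in>U. - 2 * x u c"] by simp
  also have "\<dots> = (\<Sum>c\<in>C. \<Prod>u\<in>U. exp (- 2 * x u c))"
    using \<open>finite U\<close> by (simp only: exp_sum)
  also have "\<dots> \<le> (\<Sum>c\<in>C. \<Prod>u\<in>U. 1 - x u c)"
    by (intro sum_mono prod_mono) (use exp_minus_double_le_one_minus x in auto)
  finally show ?thesis .
qed

section \<open>Probability mass functions\<close>

lemma (in prob_space) expectation_le_add_prob:
  fixes Y :: "'a \<Rightarrow> real"
  assumes Y: "integrable M Y" and bound: "\<And>\<omega>. \<omega> \<in> space M \<Longrightarrow> Y \<omega> \<le> b" and "0 \<le> a"
  shows "expectation Y \<le> a + b * \<P>(\<omega> in M. a \<le> Y \<omega>)"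
proof -
  note [measurable] = borel_measurable_integrable[OF Y]
  have "expectation Y \<le> expectation (\<lambda>\<omega>. a + b * indicator {\<omega> \<in> space M. a \<le> Y \<omega>} \<omega>)"
  proof (rule integral_mono[OF Y])
    show "Y \<omega> \<le> a + b * indicator {\<omega> \<in> space M. a \<le> Y \<omega>} \<omega>" if "\<omega> \<in> space M" for \<omega>
      using bound[OF that] \<open>0 \<le> a\<close> that by (auto simp: indicator_def)
  qed (simp add: emeasure_eq_measure)
  also have "\<dots> = a + b * \<P>(\<omega> in M. a \<le> Y \<omega>)"
    by (simp add: prob_space emeasure_eq_measure)
  finally show ?thesis .
qed

lemma nn_integral_measure_pmf_count_space:
  "(\<integral>\<^sup>+x. f x \<partial>measure_pmf p) = (\<integral>\<^sup>+x. ennreal (pmf p x) * f x \<partial>count_space (set_pmf p))"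
proof -
  have "(\<integral>\<^sup>+x. f x \<partial>measure_pmf p) = (\<integral>\<^sup>+x. ennreal (pmf p x) * f x \<partial>count_space UNIV)"
    by (subst measure_pmf_eq_density) (simp add: nn_integral_density)
  also have "\<dots> = (\<integral>\<^sup>+x. ennreal (pmf p x) * f x \<partial>count_space (set_pmf p))"
    by (rule nn_integral_count_space_eq) (auto simp: set_pmf_eq)
  finally show ?thesis .
qed

lemma prob_pmf_Compl: "measure_pmf.prob p (- A) = 1 - measure_pmf.prob p A"
  using measure_pmf.prob_compl[of A p] by (simp flip: Compl_eq_Diff_UNIV)

lemma integrable_indicator_pmf: "integrable (measure_pmf p) (indicator A :: 'a \<Rightarrow> real)"
  by (simp add: measure_pmf.emeasure_eq_measure)

lemma integrable_prob_pmf: "integrable (measure_pmf p) (\<lambda>x. measure_pmf.prob (f x) A)"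
  by (rule measure_pmf.integrable_const_bound[where B = 1]) auto

lemma prob_bind_pmf:
  "measure_pmf.prob (bind_pmf p f) A = measure_pmf.expectation p (\<lambda>x. measure_pmf.prob (f x) A)"
proof -
  have "ennreal (measure_pmf.prob (bind_pmf p f) A)
      = (\<integral>\<^sup>+x. measure_pmf.prob (f x) A \<partial>measure_pmf p)"
    by (simp flip: measure_pmf.emeasure_eq_measure)
  also have "\<dots> = ennreal (measure_pmf.expectation p (\<lambda>x. measure_pmf.prob (f x) A))"
    by (intro nn_integral_eq_integral integrable_prob_pmf) simp
  finally show ?thesis
    by (simp add: integral_nonneg)
qed

lemma prob_bind_pmf_ge:
  assumes "\<And>x. x \<in> set_pmf p \<Longrightarrow> x \<in> B \<Longrightarrow> r \<le> measure_pmf.prob (f x) A"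
  shows "measure_pmf.prob p B * r \<le> measure_pmf.prob (bind_pmf p f) A"
proof -
  have "measure_pmf.prob p B * r = measure_pmf.expectation p (\<lambda>x. indicator B x * r)"
    by simp
  also have "\<dots> \<le> measure_pmf.expectation p (\<lambda>x. measure_pmf.prob (f x) A)"
    using assms
    by (intro integral_mono_AE integrable_prob_pmf integrable_mult_left integrable_indicator_pmf)
      (auto simp: AE_measure_pmf_iff indicator_def)
  finally show ?thesis
    by (simp only: prob_bind_pmf)
qed

lemma prob_bind_pmf_le:
  assumes "\<And>x. x \<in> set_pmf p \<Longrightarrow> measure_pmf.prob (f x) A \<le> indicator B x * r"
  shows "measure_pmf.prob (bind_pmf p f) A \<le> measure_pmf.prob p B * r"
proof -
  have "measure_pmf.expectation p (\<lambda>x. measure_pmf.prob (f x) A)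
      \<le> measure_pmf.expectation p (\<lambda>x. indicator B x * r)"
    using assms
    by (intro integral_mono_AE integrable_prob_pmf integrable_mult_left integrable_indicator_pmf)
      (auto simp: AE_measure_pmf_iff)
  also have "\<dots> = measure_pmf.prob p B * r"
    by simp
  finally show ?thesis
    by (simp only: prob_bind_pmf)
qed

lemma prob_Pi_pmf_Ball:
  assumes "finite A" "B \<subseteq> A"
  shows "measure_pmf.prob (Pi_pmf A dflt p) {f. \<forall>x\<in>B. f x \<in> S x}
    = (\<Prod>x\<in>B. measure_pmf.prob (p x) (S x))"
proof -
  let ?T = "\<lambda>x. if x \<in> B then S x else UNIV"
  have "{f. \<forall>x\<in>B. f x \<in> S x} = Pi A ?T"
    using \<open>B \<subseteq> A\<close> by (auto simp: Pi_def)
  then have "measure_pmf.prob (Pi_pmf A dflt p) {f. \<forall>x\<in>B. f x \<in> S x}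
      = (\<Prod>x\<in>A. measure_pmf.prob (p x) (?T x))"
    using \<open>finite A\<close> by (simp add: measure_Pi_pmf_Pi)
  also have "\<dots> = (\<Prod>x\<in>B. measure_pmf.prob (p x) (S x))"
    using assms by (intro prod.mono_neutral_cong_right) auto
  finally show ?thesis .
qed

lemma expectation_card_Collect:
  assumes "finite A"
  shows "measure_pmf.expectation p (\<lambda>x. real (card {a \<in> A. P a x}))
    = (\<Sum>a\<in>A. measure_pmf.prob p {x. P a x})"
proof -
  have "real (card {a \<in> A. P a x}) = (\<Sum>a\<in>A. indicator {x. P a x} x)" for x
    using assms by (simp add: indicator_def sum.If_cases Int_def)
  then show ?thesis
    by (simp add: integrable_indicator_pmf)
qed

section \<open>Iterated kernels and Markov chains\<close>

primrec iterate_pmf :: "('s \<Rightarrow> 's pmf) \<Rightarrow> nat \<Rightarrow> 's \<Rightarrow> 's pmf" where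
  "iterate_pmf K 0 x = return_pmf x"
| "iterate_pmf K (Suc k) x = bind_pmf (K x) (iterate_pmf K k)"

lemma iterate_pmf_add:
  "iterate_pmf K (j + k) x = bind_pmf (iterate_pmf K j x) (iterate_pmf K k)"
  by (induction j arbitrary: x) (simp_all add: bind_return_pmf bind_assoc_pmf cong: bind_pmf_cong)

lemma set_iterate_pmf_closed:
  assumes "\<And>x y. x \<in> S \<Longrightarrow> y \<in> set_pmf (K x) \<Longrightarrow> y \<in> S"
    and "x \<in> S" "y \<in> set_pmf (iterate_pmf K k x)"
  shows "y \<in> S"
  using assms(2,3) by (induction k arbitrary: x) (auto dest: assms(1))

lemma prob_iterate_pmf_not_absorbed_le:
  assumes closed: "\<And>x y. x \<in> S \<Longrightarrow> y \<in> set_pmf (K x) \<Longrightarrow> y \<in> S"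
    and absorb: "\<And>x. p \<le> measure_pmf.prob (iterate_pmf K m x) S"
  shows "measure_pmf.prob (iterate_pmf K (m * t) x) (- S) \<le> (1 - p) ^ t"
proof (induction t arbitrary: x)
  case (Suc t)
  have "measure_pmf.prob (iterate_pmf K (m * Suc t) x) (- S)
      = measure_pmf.prob (bind_pmf (iterate_pmf K m x) (iterate_pmf K (m * t))) (- S)"
    by (simp add: iterate_pmf_add)
  also have "\<dots> \<le> measure_pmf.prob (iterate_pmf K m x) (- S) * (1 - p) ^ t"
  proof (rule prob_bind_pmf_le)
    fix y
    show "measure_pmf.prob (iterate_pmf K (m * t) y) (- S) \<le> indicator (- S) y * (1 - p) ^ t"
    proof (cases "y \<in> S")
      case True
      have "z \<in> S" if "z \<in> set_pmf (iterate_pmf K (m * t) y)" for z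
        using closed True that by (rule set_iterate_pmf_closed)
      then have "measure_pmf.prob (iterate_pmf K (m * t) y) (- S) = 0"
        unfolding measure_pmf_zero_iff by blast
      then show ?thesis
        using True by simp
    qed (use Suc in simp)
  qed
  also have "\<dots> \<le> (1 - p) * (1 - p) ^ t"
  proof (rule mult_right_mono)
    show "measure_pmf.prob (iterate_pmf K m x) (- S) \<le> 1 - p"
      using absorb[of x] by (simp add: prob_pmf_Compl)
    show "0 \<le> (1 - p) ^ t"
      using order_trans[OF absorb measure_pmf.prob_le_1] by simp
  qed
  finally show ?case
    by simp
qed simp

locale discrete_markov_chain = prob_space M for M :: "'a measure" +
  fixes K :: "'s \<Rightarrow> 's pmf" and L :: "nat \<Rightarrow> 'a \<Rightarrow> 's"
  assumes measurable_state [measurable]: "\<And>t. L t \<in> M \<rightarrow>\<^sub>M count_space UNIV"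
    and prob_history_Suc: "\<And>t h. \<P>(\<omega> in M. \<forall>s\<le>Suc t. L s \<omega> = h s)
      = \<P>(\<omega> in M. \<forall>s\<le>t. L s \<omega> = h s) * pmf (K (h t)) (h (Suc t))"
begin

definition history :: "nat \<Rightarrow> (nat \<Rightarrow> 's) \<Rightarrow> 'a set" where
  "history t h = {\<omega> \<in> space M. \<forall>s\<le>t. L s \<omega> = h s}"

lemma sets_history [measurable]: "history t h \<in> sets M"
  unfolding history_def by measurable

lemma sets_history_state [measurable]: "{\<omega> \<in> history t h. L k \<omega> \<in> A} \<in> sets M"
proof -
  have "{\<omega> \<in> history t h. L k \<omega> \<in> A} = history t h \<inter> (L k -` A \<inter> space M)"
    by (auto simp: history_def)
  also have "\<dots> \<in> sets M"
    by (intro sets.Int sets_history measurable_sets[OF measurable_state]) simp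
  finally show ?thesis .
qed

lemma history_Suc_upd: "history (Suc t) (h(Suc t := x)) = {\<omega> \<in> history t h. L (Suc t) \<omega> = x}"
  by (auto simp: history_def le_Suc_eq)

lemma emeasure_history_Suc_upd:
  "emeasure M (history (Suc t) (h(Suc t := x))) = emeasure M (history t h) * pmf (K (h t)) x"
proof -
  have "history t (h(Suc t := x)) = history t h"
    by (auto simp: history_def)
  then show ?thesis
    using prob_history_Suc[of t "h(Suc t := x)"] unfolding history_def[symmetric]
    by (simp add: emeasure_eq_measure ennreal_mult del: fun_upd_apply add: fun_upd_same fun_upd_other)
qed

lemma AE_history_next_state:
  "AE \<omega> in M. \<omega> \<in> history t h \<longrightarrow> L (Suc t) \<omega> \<in> set_pmf (K (h t))"
proof -
  let ?S = "set_pmf (K (h t))"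
  let ?G = "\<lambda>x. history (Suc t) (h(Suc t := x))"
  have "emeasure M (\<Union>x\<in>?S. ?G x) = (\<integral>\<^sup>+x. emeasure M (?G x) \<partial>count_space ?S)"
    by (intro emeasure_UN_countable) (auto simp: disjoint_family_on_def history_Suc_upd)
  also have "\<dots> = emeasure M (history t h) * (\<integral>\<^sup>+x. pmf (K (h t)) x \<partial>count_space ?S)"
    by (simp add: emeasure_history_Suc_upd nn_integral_cmult)
  also have "(\<integral>\<^sup>+x. pmf (K (h t)) x \<partial>count_space ?S) = 1"
    by (simp add: nn_integral_pmf emeasure_pmf)
  finally have "emeasure M (\<Union>x\<in>?S. ?G x) = emeasure M (history t h)"
    by (simp only: mult_1_right)
  moreover have "emeasure M (history t h - (\<Union>x\<in>?S. ?G x))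
      = emeasure M (history t h) - emeasure M (\<Union>x\<in>?S. ?G x)"
    by (intro emeasure_Diff sets.countable_UN') (auto simp: history_Suc_upd)
  ultimately have "history t h - (\<Union>x\<in>?S. ?G x) \<in> null_sets M"
    by (intro null_setsI sets.Diff sets.countable_UN') auto
  from AE_not_in[OF this] show ?thesis
    by eventually_elim (auto simp: history_Suc_upd)
qed

lemma emeasure_history_iterate:
  "emeasure M {\<omega> \<in> history t h. L (t + k) \<omega> \<in> A}
    = emeasure M (history t h) * emeasure (iterate_pmf K k (h t)) A"
proof (induction k arbitrary: t h)
  case 0
  have "{\<omega> \<in> history t h. L (t + 0) \<omega> \<in> A} = (if h t \<in> A then history t h else {})"
    by (auto simp: history_def)
  then show ?case
    by (simp add: emeasure_return_pmf)
next
  case (Suc k)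
  let ?S = "set_pmf (K (h t))"
  let ?G = "\<lambda>x. {\<omega> \<in> history (Suc t) (h(Suc t := x)). L (Suc t + k) \<omega> \<in> A}"
  have "emeasure M {\<omega> \<in> history t h. L (t + Suc k) \<omega> \<in> A} = emeasure M (\<Union>x\<in>?S. ?G x)"
  proof (rule emeasure_eq_AE)
    show "AE \<omega> in M. \<omega> \<in> {\<omega> \<in> history t h. L (t + Suc k) \<omega> \<in> A} \<longleftrightarrow> \<omega> \<in> (\<Union>x\<in>?S. ?G x)"
      using AE_history_next_state[of t h] by eventually_elim (auto simp: history_Suc_upd)
  qed (auto intro!: sets.countable_UN')
  also have "\<dots> = (\<integral>\<^sup>+x. emeasure M (?G x) \<partial>count_space ?S)"
    by (intro emeasure_UN_countable sets_history_state)
      (auto simp: disjoint_family_on_def history_Suc_upd)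
  also have "\<dots> = (\<integral>\<^sup>+x. emeasure M (history t h) *
      (ennreal (pmf (K (h t)) x) * emeasure (iterate_pmf K k x) A) \<partial>count_space ?S)"
    using Suc[of "Suc t"]
    by (simp add: emeasure_history_Suc_upd mult.assoc fun_upd_same del: fun_upd_apply)
  also have "\<dots> = emeasure M (history t h) * emeasure (iterate_pmf K (Suc k) (h t)) A"
    by (simp add: nn_integral_cmult nn_integral_measure_pmf_count_space)
  finally show ?case .
qed

lemma prob_state_eq_iterate:
  assumes "\<And>\<omega>. \<omega> \<in> space M \<Longrightarrow> L 0 \<omega> = x"
  shows "\<P>(\<omega> in M. L k \<omega> \<in> A) = measure_pmf.prob (iterate_pmf K k x) A"
proof -
  have "history 0 (\<lambda>_. x) = space M"
    using assms by (auto simp: history_def)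
  then have "emeasure M {\<omega> \<in> space M. L k \<omega> \<in> A} = emeasure (iterate_pmf K k x) A"
    using emeasure_history_iterate[of 0 "\<lambda>_. x" k A] by (simp add: emeasure_space_1)
  then show ?thesis
    by (simp add: measure_def)
qed

end

section \<open>The coloring game\<close>

text \<open>
  After one round, the fraction of unblocked colors that are free has mean at least \<open>exp (- 2)\<close>
  and is at most 1, so it reaches half of \<open>exp (- 2)\<close> with probability at least that half.
\<close>

definition free_fraction :: real where
  "free_fraction = exp (- 2) / 2"

definition recovery_prob :: real where
  "recovery_prob = free_fraction * exp (- 2 / free_fraction)"

lemma free_fraction_bounds: "0 < free_fraction" "free_fraction \<le> 1"
proof -
  show "0 < free_fraction"
    by (simp add: free_fraction_def)
  have "exp (- 2 :: real) \<le> 1"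
    by simp
  then show "free_fraction \<le> 1"
    unfolding free_fraction_def by linarith
qed

lemma recovery_prob_bounds: "0 < recovery_prob" "recovery_prob \<le> 1"
  using free_fraction_bounds by (simp_all add: recovery_prob_def mult_le_one)

lemma card_neighbours_le_max_degree: "i \<in> {1..n} \<Longrightarrow> card (neighbours E i) \<le> max_degree n E"
  unfolding max_degree_def by (intro Max_ge) auto

locale greedy_coloring =
  fixes n q :: nat and E :: "nat rel"
  assumes graph: "simple_graph n E"
    and enough_colors: "max_degree n E + 2 \<le> q"
begin

abbreviation step :: "(nat \<Rightarrow> nat) \<Rightarrow> (nat \<Rightarrow> nat) pmf" where
  "step \<equiv> next_state n q E"

definition happy :: "(nat \<Rightarrow> nat) \<Rightarrow> nat \<Rightarrow> bool" where
  "happy l i \<longleftrightarrow> (\<forall>j\<in>neighbours E i. l i \<noteq> l j)"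

definition resolved :: "(nat \<Rightarrow> nat) \<Rightarrow> bool" where
  "resolved l \<longleftrightarrow> (\<forall>i\<in>{1..n}. happy l i)"

definition unhappy_neighbours :: "(nat \<Rightarrow> nat) \<Rightarrow> nat \<Rightarrow> nat set" where
  "unhappy_neighbours l i = {j \<in> neighbours E i. \<not> happy l j}"

definition free_colors :: "(nat \<Rightarrow> nat) \<Rightarrow> nat \<Rightarrow> nat set" where
  "free_colors l i = {1..q} - l ` neighbours E i"

definition unblocked_colors :: "(nat \<Rightarrow> nat) \<Rightarrow> nat \<Rightarrow> nat set" where
  "unblocked_colors l i = {1..q} - l ` (neighbours E i - unhappy_neighbours l i)"

lemma payoff_eq_1_iff: "payoff E l i = 1 \<longleftrightarrow> happy l i"
  by (simp add: payoff_def happy_def)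

subsection \<open>Neighbours and colors\<close>

lemma neighbours_subset: "neighbours E i \<subseteq> {1..n}"
  using graph by (auto simp: simple_graph_def neighbours_def)

lemma finite_neighbours [simp]: "finite (neighbours E i)"
  using neighbours_subset finite_subset by blast

lemma neighbours_sym: "j \<in> neighbours E i \<Longrightarrow> i \<in> neighbours E j"
  using graph by (auto simp: simple_graph_def neighbours_def sym_def)

lemma not_neighbour_self [simp]: "i \<notin> neighbours E i"
  using graph by (auto simp: simple_graph_def neighbours_def irrefl_def)

lemma finite_unhappy_neighbours [simp]: "finite (unhappy_neighbours l i)"
  by (simp add: unhappy_neighbours_def)

lemma finite_unblocked_colors [simp]: "finite (unblocked_colors l i)"
  by (simp add: unblocked_colors_def)

lemma finite_free_colors [simp]: "finite (free_colors l i)"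
  by (simp add: free_colors_def)

lemma free_colors_subset_unblocked: "free_colors l i \<subseteq> unblocked_colors l i"
  by (auto simp: free_colors_def unblocked_colors_def)

lemma card_colors_Diff_image:
  assumes "i \<in> {1..n}" "B \<subseteq> neighbours E i"
  shows "card (neighbours E i - B) + 2 \<le> card ({1..q} - l ` B)"
proof -
  have "card (l ` B) \<le> card B"
    using assms(2) by (simp add: card_image_le finite_subset)
  moreover have "q - card (l ` B) \<le> card ({1..q} - l ` B)"
    using diff_card_le_card_Diff[of "l ` B" "{1..q}"] assms(2) by (simp add: finite_subset)
  moreover have "card (neighbours E i - B) + card B = card (neighbours E i)"
    using assms(2) by (simp add: card_Diff_subset card_mono finite_subset)
  ultimately show ?thesis
    using enough_colors card_neighbours_le_max_degree[OF assms(1), of E] by linarith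
qed

lemma card_free_colors_ge:
  assumes "i \<in> {1..n}"
  shows "2 \<le> card (free_colors l i)"
  using card_colors_Diff_image[OF assms order_refl, of l] by (simp add: free_colors_def)

lemma free_colors_nonempty:
  assumes "i \<in> {1..n}"
  shows "free_colors l i \<noteq> {}"
  using card_free_colors_ge[OF assms, of l] by auto

lemma unblocked_colors_nonempty:
  assumes "i \<in> {1..n}"
  shows "unblocked_colors l i \<noteq> {}"
  using free_colors_subset_unblocked free_colors_nonempty[OF assms] by blast

lemma card_unhappy_neighbours_le_unblocked:
  assumes "i \<in> {1..n}"
  shows "card (unhappy_neighbours l i) \<le> card (unblocked_colors l i)"
proof -
  have "neighbours E i - (neighbours E i - unhappy_neighbours l i) = unhappy_neighbours l i"
    by (auto simp: unhappy_neighbours_def)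
  then show ?thesis
    using card_colors_Diff_image[OF assms Diff_subset, of "unhappy_neighbours l i" l]
    by (simp add: unblocked_colors_def)
qed

subsection \<open>One round\<close>

lemma next_color_eq:
  "next_color q E l i = (if happy l i then return_pmf (l i) else pmf_of_set (free_colors l i))"
  unfolding next_color_def payoff_eq_1_iff free_colors_def ..

lemma pmf_next_color_unhappy:
  assumes "i \<in> {1..n}" "\<not> happy l i"
  shows "pmf (next_color q E l i) c = indicator (free_colors l i) c / card (free_colors l i)"
  using assms free_colors_nonempty[OF assms(1), of l] by (simp add: next_color_eq pmf_of_set)

lemma pmf_next_color_unhappy_le:
  assumes "i \<in> {1..n}" "\<not> happy l i"
  shows "pmf (next_color q E l i) c \<le> 1 / 2"
proof -
  have "pmf (next_color q E l i) c \<le> 1 / card (free_colors l i)"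
    by (simp add: pmf_next_color_unhappy[OF assms] indicator_def)
  also have "\<dots> \<le> 1 / 2"
    using card_free_colors_ge[OF assms(1), of l] by (intro divide_left_mono) auto
  finally show ?thesis .
qed

lemma step_next_color:
  assumes "l' \<in> set_pmf (step l)" "i \<in> {1..n}"
  shows "happy l i \<Longrightarrow> l' i = l i" "\<not> happy l i \<Longrightarrow> l' i \<in> free_colors l i"
proof -
  have "l' i \<in> set_pmf (next_color q E l i)"
    using assms by (auto simp: next_state_def set_Pi_pmf PiE_dflt_def)
  then show "happy l i \<Longrightarrow> l' i = l i" "\<not> happy l i \<Longrightarrow> l' i \<in> free_colors l i"
    using free_colors_nonempty[OF assms(2), of l] by (auto simp: next_color_eq)
qed

lemma happy_step:
  assumes "l' \<in> set_pmf (step l)" "i \<in> {1..n}" "happy l i"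
  shows "happy l' i"
  unfolding happy_def
proof
  fix j assume j: "j \<in> neighbours E i"
  then have "j \<in> {1..n}"
    using neighbours_subset by blast
  moreover have "l i \<notin> free_colors l j"
    using neighbours_sym[OF j] by (auto simp: free_colors_def)
  ultimately have "l' j \<noteq> l i"
    using step_next_color[OF assms(1), of j] assms(3) j by (cases "happy l j") (auto simp: happy_def)
  then show "l' i \<noteq> l' j"
    using step_next_color(1)[OF assms] by simp
qed

lemma unhappy_neighbours_step:
  assumes "l' \<in> set_pmf (step l)"
  shows "unhappy_neighbours l' i \<subseteq> unhappy_neighbours l i"
  using happy_step[OF assms] neighbours_subset unfolding unhappy_neighbours_def by blast

lemma prob_color_avoided:
  "measure_pmf.prob (step l) {l'. c \<notin> l' ` neighbours E i}
    = (\<Prod>u\<in>neighbours E i. 1 - pmf (next_color q E l u) c)"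
proof -
  have "{l'. c \<notin> l' ` neighbours E i} = {l'. \<forall>u\<in>neighbours E i. l' u \<in> - {c}}"
    by auto
  then show ?thesis
    by (simp only: next_state_def prob_Pi_pmf_Ball finite_atLeastAtMost neighbours_subset
        prob_pmf_Compl measure_pmf_single)
qed

lemma prob_color_chosen_and_avoided:
  assumes "i \<in> {1..n}"
  shows "measure_pmf.prob (step l) {l'. l' i = c \<and> c \<notin> l' ` neighbours E i}
    = pmf (next_color q E l i) c * measure_pmf.prob (step l) {l'. c \<notin> l' ` neighbours E i}"
proof -
  let ?S = "\<lambda>u. if u = i then {c} else - {c}"
  have "u \<noteq> i" if "u \<in> neighbours E i" for u
    using that by auto
  then have "{l'. l' i = c \<and> c \<notin> l' ` neighbours E i}
      = {l'. \<forall>u\<in>insert i (neighbours E i). l' u \<in> ?S u}"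
    by (auto simp: image_iff)
  then have "measure_pmf.prob (step l) {l'. l' i = c \<and> c \<notin> l' ` neighbours E i}
      = (\<Prod>u\<in>insert i (neighbours E i). measure_pmf.prob (next_color q E l u) (?S u))"
    using assms neighbours_subset by (simp only: next_state_def prob_Pi_pmf_Ball
        finite_atLeastAtMost insert_subset simp_thms)
  also have "\<dots> = pmf (next_color q E l i) c *
      (\<Prod>u\<in>neighbours E i. measure_pmf.prob (next_color q E l u) (?S u))"
    by (simp add: measure_pmf_single)
  also have "(\<Prod>u\<in>neighbours E i. measure_pmf.prob (next_color q E l u) (?S u))
      = measure_pmf.prob (step l) {l'. c \<notin> l' ` neighbours E i}"
    unfolding prob_color_avoided
    by (intro prod.cong) (auto simp: prob_pmf_Compl measure_pmf_single)
  finally show ?thesis .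
qed

lemma prob_unblocked_color_avoided:
  assumes "c \<in> unblocked_colors l i"
  shows "measure_pmf.prob (step l) {l'. c \<notin> l' ` neighbours E i}
    = (\<Prod>u\<in>unhappy_neighbours l i. 1 - pmf (next_color q E l u) c)"
  unfolding prob_color_avoided
proof (rule prod.mono_neutral_right)
  show "\<forall>u\<in>neighbours E i - unhappy_neighbours l i. 1 - pmf (next_color q E l u) c = 1"
  proof
    fix u assume u: "u \<in> neighbours E i - unhappy_neighbours l i"
    then have "happy l u" "l u \<noteq> c"
      using assms by (auto simp: unhappy_neighbours_def unblocked_colors_def)
    then show "1 - pmf (next_color q E l u) c = 1"
      by (simp add: next_color_eq)
  qed
qed (auto simp: unhappy_neighbours_def)

lemma sum_prob_color_avoided_ge:
  assumes "C \<subseteq> unblocked_colors l i" "C \<noteq> {}"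
  shows "card C * exp (- 2 * (card (unhappy_neighbours l i) / card C))
    \<le> (\<Sum>c\<in>C. measure_pmf.prob (step l) {l'. c \<notin> l' ` neighbours E i})"
proof -
  let ?U = "unhappy_neighbours l i"
  have "finite C"
    using assms(1) by (rule finite_subset) simp
  have "(\<Sum>u\<in>?U. \<Sum>c\<in>C. pmf (next_color q E l u) c) \<le> (\<Sum>u\<in>?U. 1)"
    by (intro sum_mono) (simp add: \<open>finite C\<close> flip: measure_measure_pmf_finite)
  then have "card C * exp (- 2 * (card ?U / card C))
      \<le> card C * exp (- 2 * ((\<Sum>u\<in>?U. \<Sum>c\<in>C. pmf (next_color q E l u) c) / card C))"
    by (simp add: divide_right_mono mult_left_mono)
  also have "\<dots> \<le> (\<Sum>c\<in>C. \<Prod>u\<in>?U. 1 - pmf (next_color q E l u) c)"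
  proof (rule sum_prod_one_minus_ge[OF \<open>finite C\<close> assms(2) finite_unhappy_neighbours])
    show "0 \<le> pmf (next_color q E l u) c \<and> pmf (next_color q E l u) c \<le> 1 / 2" if "u \<in> ?U" for u c
    proof -
      have "u \<in> {1..n}" "\<not> happy l u"
        using that neighbours_subset unfolding unhappy_neighbours_def by blast+
      then show ?thesis
        using pmf_next_color_unhappy_le by simp
    qed
  qed
  also have "\<dots> = (\<Sum>c\<in>C. measure_pmf.prob (step l) {l'. c \<notin> l' ` neighbours E i})"
    using assms(1) by (intro sum.cong) (auto simp: prob_unblocked_color_avoided)
  finally show ?thesis .
qed

lemma prob_unhappy_becomes_happy_ge:
  assumes "i \<in> {1..n}" "\<not> happy l i"
  shows "exp (- 2 * (card (unhappy_neighbours l i) / card (free_colors l i)))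
    \<le> measure_pmf.prob (step l) {l'. happy l' i}"
proof -
  let ?F = "free_colors l i"
  let ?avoided = "\<lambda>c. {l'. c \<notin> l' ` neighbours E i}"
  have "card ?F > 0"
    using card_free_colors_ge[OF assms(1), of l] by simp
  then have "exp (- 2 * (card (unhappy_neighbours l i) / card ?F))
      \<le> (\<Sum>c\<in>?F. measure_pmf.prob (step l) (?avoided c)) / card ?F"
    using sum_prob_color_avoided_ge[OF free_colors_subset_unblocked free_colors_nonempty[OF assms(1)]]
    by (simp add: pos_le_divide_eq mult.commute)
  also have "\<dots> = (\<Sum>c\<in>?F. measure_pmf.prob (step l) {l'. l' i = c \<and> l' \<in> ?avoided c})"
    by (simp add: prob_color_chosen_and_avoided[OF assms(1)] pmf_next_color_unhappy[OF assms]
        sum_divide_distrib)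
  also have "\<dots> = measure_pmf.prob (step l) (\<Union>c\<in>?F. {l'. l' i = c \<and> l' \<in> ?avoided c})"
    by (rule measure_pmf.finite_measure_finite_Union[symmetric])
      (auto simp: disjoint_family_on_def)
  also have "\<dots> \<le> measure_pmf.prob (step l) {l'. happy l' i}"
    by (rule measure_pmf.finite_measure_mono) (auto simp: happy_def)
  finally show ?thesis .
qed

lemma prob_happy_step_ge:
  fixes r :: real
  assumes "i \<in> {1..n}" and le: "card (unhappy_neighbours l i) \<le> r * card (free_colors l i)"
  shows "exp (- 2 * r) \<le> measure_pmf.prob (step l) {l'. happy l' i}"
proof (cases "happy l i")
  case True
  have "card (free_colors l i) > 0"
    using card_free_colors_ge[OF assms(1), of l] by simp
  moreover have "0 \<le> r * card (free_colors l i)"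
    using le by linarith
  ultimately have "0 \<le> r"
    by (auto simp: zero_le_mult_iff card_gt_0_iff)
  moreover have "measure_pmf.prob (step l) {l'. happy l' i} = 1"
    using happy_step[OF _ assms(1) True] by (simp add: measure_pmf.prob_eq_1 AE_measure_pmf_iff)
  ultimately show ?thesis
    by simp
next
  case False
  have "card (unhappy_neighbours l i) / card (free_colors l i) \<le> r"
    using le card_free_colors_ge[OF assms(1), of l] by (simp add: pos_divide_le_eq)
  then have "exp (- 2 * r) \<le> exp (- 2 * (card (unhappy_neighbours l i) / card (free_colors l i)))"
    by simp
  also have "\<dots> \<le> measure_pmf.prob (step l) {l'. happy l' i}"
    by (rule prob_unhappy_becomes_happy_ge[OF assms(1) False])
  finally show ?thesis .
qed

subsection \<open>Two rounds\<close>

lemma expectation_card_free_unblocked_colors_ge: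
  assumes "i \<in> {1..n}"
  shows "card (unblocked_colors l i) * exp (- 2)
    \<le> measure_pmf.expectation (step l) (\<lambda>l'. card (free_colors l' i \<inter> unblocked_colors l i))"
proof -
  let ?B = "unblocked_colors l i"
  have "?B \<noteq> {}"
    by (rule unblocked_colors_nonempty[OF assms])
  have "card (unhappy_neighbours l i) / card ?B \<le> 1"
    using card_unhappy_neighbours_le_unblocked[OF assms, of l] \<open>?B \<noteq> {}\<close>
    by (simp add: divide_le_eq_1 card_gt_0_iff)
  then have "card ?B * exp (- 2) \<le> card ?B * exp (- 2 * (card (unhappy_neighbours l i) / card ?B))"
    by (intro mult_left_mono) simp_all
  also have "\<dots> \<le> (\<Sum>c\<in>?B. measure_pmf.prob (step l) {l'. c \<notin> l' ` neighbours E i})"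
    by (rule sum_prob_color_avoided_ge[OF order_refl \<open>?B \<noteq> {}\<close>])
  also have "\<dots> = measure_pmf.expectation (step l) (\<lambda>l'. card (free_colors l' i \<inter> ?B))"
  proof -
    have "free_colors l' i \<inter> ?B = {c \<in> ?B. c \<notin> l' ` neighbours E i}" for l'
      by (auto simp: free_colors_def unblocked_colors_def)
    then show ?thesis
      by (simp add: expectation_card_Collect)
  qed
  finally show ?thesis .
qed

lemma prob_many_free_colors_ge:
  assumes "i \<in> {1..n}"
  shows "free_fraction \<le> measure_pmf.prob (step l)
    {l'. free_fraction * card (unblocked_colors l i) \<le> card (free_colors l' i)}"
proof -
  let ?B = "unblocked_colors l i"
  let ?Y = "\<lambda>l'. real (card (free_colors l' i \<inter> ?B))"
  have Y_le: "?Y l' \<le> card ?B" for l'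
    by (simp add: card_mono)
  have "?B \<noteq> {}"
    by (rule unblocked_colors_nonempty[OF assms])
  have "free_fraction * card ?B + card ?B * free_fraction = card ?B * exp (- 2)"
    by (simp add: free_fraction_def)
  also have "\<dots> \<le> measure_pmf.expectation (step l) ?Y"
    by (rule expectation_card_free_unblocked_colors_ge[OF assms])
  also have "\<dots> \<le> free_fraction * card ?B
      + card ?B * \<P>(l' in measure_pmf (step l). free_fraction * card ?B \<le> ?Y l')"
    using Y_le free_fraction_bounds
    by (intro measure_pmf.expectation_le_add_prob
        measure_pmf.integrable_const_bound[where B = "card ?B"]) auto
  finally have "free_fraction \<le> measure_pmf.prob (step l) {l'. free_fraction * card ?B \<le> ?Y l'}"
    using \<open>?B \<noteq> {}\<close> by (simp add: card_gt_0_iff)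
  also have "\<dots> \<le> measure_pmf.prob (step l) {l'. free_fraction * card ?B \<le> card (free_colors l' i)}"
    by (intro measure_pmf.finite_measure_mono)
      (auto elim!: order_trans simp: card_mono)
  finally show ?thesis .
qed

lemma prob_happy_two_steps_ge:
  assumes "i \<in> {1..n}"
  shows "recovery_prob \<le> measure_pmf.prob (iterate_pmf step 2 l) {l'. happy l' i}"
proof -
  define many_free where
    "many_free = {l'. free_fraction * card (unblocked_colors l i) \<le> card (free_colors l' i)}"
  have "recovery_prob \<le> measure_pmf.prob (step l) many_free * exp (- 2 / free_fraction)"
    unfolding recovery_prob_def many_free_def
    by (intro mult_right_mono prob_many_free_colors_ge[OF assms]) simp
  also have "\<dots> \<le> measure_pmf.prob (bind_pmf (step l) step) {l'. happy l' i}"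
  proof (rule prob_bind_pmf_ge)
    fix l' assume l': "l' \<in> set_pmf (step l)" "l' \<in> many_free"
    have "card (unhappy_neighbours l' i) \<le> card (unhappy_neighbours l i)"
      by (intro card_mono unhappy_neighbours_step[OF l'(1)]) simp
    also have "\<dots> \<le> card (unblocked_colors l i)"
      by (rule card_unhappy_neighbours_le_unblocked[OF assms])
    finally have "real (card (unhappy_neighbours l' i)) \<le> card (unblocked_colors l i)"
      by simp
    also have "\<dots> \<le> 1 / free_fraction * card (free_colors l' i)"
      using l'(2) free_fraction_bounds by (simp add: many_free_def field_simps)
    finally show "exp (- 2 / free_fraction) \<le> measure_pmf.prob (step l') {l''. happy l'' i}"
      using prob_happy_step_ge[OF assms] by fastforce
  qed
  also have "bind_pmf (step l) step = iterate_pmf step 2 l"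
    by (simp add: numeral_2_eq_2 bind_return_pmf' cong: bind_pmf_cong)
  finally show ?thesis .
qed

subsection \<open>Many rounds\<close>

lemma prob_unhappy_iterate_le:
  assumes "i \<in> {1..n}"
  shows "measure_pmf.prob (iterate_pmf step (2 * t) l) {l'. \<not> happy l' i} \<le> (1 - recovery_prob) ^ t"
proof -
  have "measure_pmf.prob (iterate_pmf step (2 * t) l) (- {l'. happy l' i}) \<le> (1 - recovery_prob) ^ t"
    using happy_step[OF _ assms] prob_happy_two_steps_ge[OF assms]
    by (intro prob_iterate_pmf_not_absorbed_le) blast+
  then show ?thesis
    by (simp only: Collect_neg_eq)
qed

lemma prob_unresolved_iterate_le:
  "measure_pmf.prob (iterate_pmf step (2 * t) l) {l'. \<not> resolved l'} \<le> n * (1 - recovery_prob) ^ t"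
proof -
  have "{l'. \<not> resolved l'} = (\<Union>i\<in>{1..n}. {l'. \<not> happy l' i})"
    by (auto simp: resolved_def)
  then have "measure_pmf.prob (iterate_pmf step (2 * t) l) {l'. \<not> resolved l'}
      \<le> (\<Sum>i\<in>{1..n}. measure_pmf.prob (iterate_pmf step (2 * t) l) {l'. \<not> happy l' i})"
    by (simp add: measure_pmf.finite_measure_subadditive_finite)
  also have "\<dots> \<le> (\<Sum>i\<in>{1..n}. (1 - recovery_prob) ^ t)"
    by (intro sum_mono prob_unhappy_iterate_le)
  finally show ?thesis
    by simp
qed

lemma resolving_time_le: "resolved (l t) \<Longrightarrow> resolving_time n E l \<le> enat t"
  unfolding resolving_time_def payoff_eq_1_iff by (intro Inf_lower) (simp add: resolved_def)

end

section \<open>Tail of the resolving time\<close>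

locale greedy_selfish_play = greedy_coloring n q E
  for n q :: nat and E :: "nat rel" +
  fixes M :: "'a measure" and l0 :: "nat \<Rightarrow> nat" and L :: "nat \<Rightarrow> 'a \<Rightarrow> nat \<Rightarrow> nat"
  assumes game: "greedy_selfish_game M n q E l0 L"
begin

sublocale discrete_markov_chain M step L
  using game
  by (auto simp: greedy_selfish_game_def discrete_markov_chain_def discrete_markov_chain_axioms_def)

lemma prob_unresolved_le: "\<P>(\<omega> in M. \<not> resolved (L (2 * t) \<omega>)) \<le> n * exp (- recovery_prob * t)"
proof -
  have "L 0 \<omega> = l0" if "\<omega> \<in> space M" for \<omega>
    using that game by (simp add: greedy_selfish_game_def)
  then have "\<P>(\<omega> in M. \<not> resolved (L (2 * t) \<omega>))
      = measure_pmf.prob (iterate_pmf step (2 * t) l0) {l. \<not> resolved l}"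
    using prob_state_eq_iterate[of l0 "2 * t" "{l. \<not> resolved l}"] by simp
  also have "\<dots> \<le> n * (1 - recovery_prob) ^ t"
    by (rule prob_unresolved_iterate_le)
  also have "\<dots> \<le> n * exp (- recovery_prob) ^ t"
    using exp_ge_add_one_self[of "- recovery_prob"] recovery_prob_bounds
    by (intro mult_left_mono power_mono) auto
  finally show ?thesis
    by (simp only: exp_of_nat2_mult)
qed

lemma prob_resolving_time_gt_le:
  assumes "0 \<le> x"
  shows "\<P>(\<omega> in M. ereal x < ereal_of_enat (resolving_time n E (\<lambda>t. L t \<omega>)))
    \<le> n * exp (recovery_prob * (1 - x / 2))"
proof -
  define t where "t = nat \<lfloor>x / 2\<rfloor>"
  have "real t = \<lfloor>x / 2\<rfloor>"
    using assms by (simp add: t_def)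
  then have t: "2 * real t \<le> x" "x / 2 - 1 \<le> t"
    by linarith+
  have "\<not> resolved (L (2 * t) \<omega>)"
    if "ereal x < ereal_of_enat (resolving_time n E (\<lambda>t. L t \<omega>))" for \<omega>
  proof
    assume "resolved (L (2 * t) \<omega>)"
    then have "resolving_time n E (\<lambda>t. L t \<omega>) \<le> enat (2 * t)"
      by (rule resolving_time_le)
    then have "ereal_of_enat (resolving_time n E (\<lambda>t. L t \<omega>)) \<le> ereal_of_enat (enat (2 * t))"
      by (simp only: ereal_of_enat_le_iff)
    also have "\<dots> \<le> ereal x"
      using t(1) by simp
    finally show False
      using that by simp
  qed
  moreover have [measurable]: "Measurable.pred (count_space UNIV) resolved"
    by simp
  ultimately have "\<P>(\<omega> in M. ereal x < ereal_of_enat (resolving_time n E (\<lambda>t. L t \<omega>)))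
      \<le> \<P>(\<omega> in M. \<not> resolved (L (2 * t) \<omega>))"
    by (intro finite_measure_mono) auto
  also have "\<dots> \<le> n * exp (- recovery_prob * t)"
    by (rule prob_unresolved_le)
  also have "\<dots> \<le> n * exp (recovery_prob * (1 - x / 2))"
  proof -
    have "recovery_prob * (x / 2 - 1) \<le> recovery_prob * t"
      using t(2) recovery_prob_bounds by (intro mult_left_mono) auto
    then show ?thesis
      by (intro mult_left_mono) (simp_all add: algebra_simps)
  qed
  finally show ?thesis .
qed

lemma prob_resolving_time_gt_ln_le:
  assumes "n > 1"
  shows "\<P>(\<omega> in M. ereal (4 / recovery_prob) < ereal_of_enat (resolving_time n E (\<lambda>t. L t \<omega>)) / ln n)
    \<le> exp 1 / n"
proof -
  have "ln n > 0"
    using assms by simp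
  then have "\<P>(\<omega> in M. ereal (4 / recovery_prob)
        < ereal_of_enat (resolving_time n E (\<lambda>t. L t \<omega>)) / ln n)
      = \<P>(\<omega> in M. ereal (4 / recovery_prob * ln n)
        < ereal_of_enat (resolving_time n E (\<lambda>t. L t \<omega>)))"
    by (simp add: ereal_less_divide_pos mult.commute)
  also have "\<dots> \<le> n * exp (recovery_prob * (1 - 4 / recovery_prob * ln n / 2))"
    using \<open>ln n > 0\<close> recovery_prob_bounds by (intro prob_resolving_time_gt_le) simp
  also have "\<dots> = n * exp (recovery_prob - 2 * ln n)"
    using recovery_prob_bounds by (simp add: algebra_simps)
  also have "\<dots> \<le> n * exp (1 - 2 * ln n)"
    using recovery_prob_bounds by (intro mult_left_mono) auto
  also have "\<dots> = exp 1 / n"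
    using assms by (simp add: exp_diff exp_double power2_eq_square)
  finally show ?thesis .
qed

end

theorem theorem3:
  fixes E :: "nat \<Rightarrow> nat rel"
    and q :: "nat \<Rightarrow> nat"
    and l0 :: "nat \<Rightarrow> nat \<Rightarrow> nat"
    and M :: "nat \<Rightarrow> 'a measure"
    and L :: "nat \<Rightarrow> nat \<Rightarrow> 'a \<Rightarrow> nat \<Rightarrow> nat"
    and X :: "nat \<Rightarrow> 'a \<Rightarrow> enat"
  assumes "\<And>n. n \<ge> 1 \<Longrightarrow> simple_graph n (E n)"
    and "\<And>n. n \<ge> 1 \<Longrightarrow> q n \<ge> max_degree n (E n) + 2"
    and "\<And>n. n \<ge> 1 \<Longrightarrow> l0 n \<in> states n (q n)"
    and "\<And>n. n \<ge> 1 \<Longrightarrow> greedy_selfish_game (M n) n (q n) (E n) (l0 n) (L n)"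
    and "\<And>n \<omega>. n \<ge> 1 \<Longrightarrow> \<omega> \<in> space (M n) \<Longrightarrow> X n \<omega> = resolving_time n (E n) (\<lambda>t. L n t \<omega>)"
  shows "\<forall>\<epsilon>>0. \<exists>C>0. \<exists>n0. \<forall>n>n0.
           \<P>(\<omega> in M n. ereal_of_enat (X n \<omega>) / ereal (ln (real n)) > ereal C) < \<epsilon>"
proof (intro allI impI)
  fix \<epsilon> :: real
  assume "\<epsilon> > 0"
  define C where "C = 4 / recovery_prob"
  have "\<P>(\<omega> in M n. ereal_of_enat (X n \<omega>) / ereal (ln (real n)) > ereal C) < \<epsilon>"
    if n: "n > nat \<lceil>exp 1 / \<epsilon>\<rceil> + 1" for n
  proof -
    interpret greedy_selfish_play n "q n" "E n" "M n" "l0 n" "L n"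
      using assms(1,2,4)[of n] n by unfold_locales simp_all
    have "\<P>(\<omega> in M n. ereal_of_enat (X n \<omega>) / ereal (ln (real n)) > ereal C)
        = \<P>(\<omega> in M n. ereal C < ereal_of_enat (resolving_time n (E n) (\<lambda>t. L n t \<omega>)) / ln n)"
      using assms(5)[of n] n by (simp cong: conj_cong)
    also have "\<dots> \<le> exp 1 / n"
      unfolding C_def using n by (intro prob_resolving_time_gt_ln_le) simp
    also have "\<dots> < \<epsilon>"
    proof -
      have "exp 1 / \<epsilon> < n"
        using n by linarith
      then show ?thesis
        using \<open>\<epsilon> > 0\<close> n by (simp add: field_simps)
    qed
    finally show ?thesis .
  qed
  moreover have "C > 0"
    using recovery_prob_bounds by (simp add: C_def)
  ultimately show "\<exists>C>0. \<exists>n0. \<forall>n>n0.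
      \<P>(\<omega> in M n. ereal_of_enat (X n \<omega>) / ereal (ln (real n)) > ereal C) < \<epsilon>"
    by blast
qed

end
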